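(* Let $(\mathsf{T},\mu,\eta)$ be a Hopf monad on a category $\mathbb{X}$ with finite biproducts that also has negatives. Then the fusion invertor $\mathsf{h}^\circ_A:\mathsf{T}(A)\to\mathsf{T}(A\oplus\mathsf{T}(\mathsf{0}))$ is of the form $$\mathsf{h}^\circ_A=\mathsf{T}(\iota_1)-\mathsf{T}(\iota_2)\circ\eta_{\mathsf{T}(\mathsf{0})}\circ\mathsf{T}(0),$$ where $0:A\to\mathsf{0}$ is the zero map, and the inverse of the fusion operator $\mathsf{h}^{-1}_{A,B}:\mathsf{T}(A)\oplus\mathsf{T}(B)\to\mathsf{T}(A\oplus\mathsf{T}(B))$ is of the form $$\mathsf{h}^{-1}_{A,B}=\mathsf{T}(\iota_1)\circ\pi_1-\mathsf{T}(\iota_2)\circ\eta_{\mathsf{T}(B)}\circ\mathsf{T}(0)\circ\pi_1+\mathsf{T}(\iota_2)\circ\eta_{\mathsf{T}(B)}\circ\pi_2,$$ where $0:A\to B$ is the zero map.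
   Context: In a category $\mathbb{X}$ with finite biproducts, $\oplus$ denotes the biproduct, with injections $\iota_j$ and projections $\pi_j$; $\mathsf{0}$ denotes the zero object; $f+g$ denotes the sum of parallel maps and $0$ the zero maps in the induced commutative monoid enrichment. The category has negatives if every map $f$ has an additive inverse $-f$ (so every homset is an Abelian group). A monad is a triple $(\mathsf{T},\mu,\eta)$ with endofunctor $\mathsf{T}$ (not assumed additive, nor to preserve zero maps), multiplication $\mu_A:\mathsf{T}\mathsf{T}(A)\to\mathsf{T}(A)$ and unit $\eta_A:A\to\mathsf{T}(A)$. The fusion operator of a monad $(\mathsf{T},\mu,\eta)$ on $\mathbb{X}$ is the natural transformation $\mathsf{h}_{A,B}:\mathsf{T}(A\oplus\mathsf{T}(B))\to\mathsf{T}(A)\oplus\mathsf{T}(B)$ defined by $\mathsf{h}_{A,B}=\iota_1\circ\mathsf{T}(\pi_1)+\iota_2\circ\mu_B\circ\mathsf{T}(\pi_2)$. The monad is a Hopf monad if $\mathsf{h}$ is a natural isomorphism. A fusion invertor for $(\mathsf{T},\mu,\eta)$ is a natural transformation $\mathsf{h}^\circ_A:\mathsf{T}(A)\to\mathsf{T}(A\oplus\mathsf{T}(\mathsf{0}))$ such that for every object $A$: [FI.1] $\mathsf{T}(\pi_1)\circ\mathsf{h}^\circ_A=1_{\mathsf{T}(A)}$; [FI.2] $\mu_{\mathsf{0}}\circ\mathsf{T}(\pi_2)\circ\mathsf{h}^\circ_A=0$; [FI.3] for every object $B$, $\mathsf{T}(1_A\oplus\mathsf{T}(0))\circ\mathsf{h}^\circ_A\circ\mathsf{T}(\pi_1)+\mathsf{T}(\iota_2)\circ\eta_{\mathsf{T}(B)}\circ\mu_B\circ\mathsf{T}(\pi_2)=1_{\mathsf{T}(A\oplus\mathsf{T}(B))}$,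 where $0:\mathsf{0}\to B$ is the zero map. Every Hopf monad on $\mathbb{X}$ has exactly one fusion invertor, namely $\mathsf{h}^\circ_A=\mathsf{h}^{-1}_{A,\mathsf{0}}\circ\iota_1$ with $\iota_1:\mathsf{T}(A)\to\mathsf{T}(A)\oplus\mathsf{T}(\mathsf{0})$; this is "the" fusion invertor. *)

theory Defs
  imports Main
begin

record ('o, 'm) category =
  Obj :: "'o set"
  Arr :: "'m set"
  Dom :: "'m \<Rightarrow> 'o"
  Cod :: "'m \<Rightarrow> 'o"
  ident :: "'o \<Rightarrow> 'm"
  comp :: "'m \<Rightarrow> 'm \<Rightarrow> 'm"  (infixr "\<cdot>\<index>" 75)

definition hom :: "('o, 'm, 'x) category_scheme \<Rightarrow> 'o \<Rightarrow> 'o \<Rightarrow> 'm set" where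
  "hom X A B = {f \<in> Arr X. Dom X f = A \<and> Cod X f = B}"

locale category =
  fixes X :: "('o, 'm, 'x) category_scheme" (structure)
  assumes Dom_Obj: "f \<in> Arr X \<Longrightarrow> Dom X f \<in> Obj X"
    and Cod_Obj: "f \<in> Arr X \<Longrightarrow> Cod X f \<in> Obj X"
    and ident_hom: "A \<in> Obj X \<Longrightarrow> ident X A \<in> hom X A A"
    and comp_hom: "\<lbrakk>f \<in> hom X A B; g \<in> hom X B C\<rbrakk> \<Longrightarrow> g \<cdot> f \<in> hom X A C"
    and comp_ident: "f \<in> hom X A B \<Longrightarrow> f \<cdot> ident X A = f"
    and ident_comp: "f \<in> hom X A B \<Longrightarrow> ident X B \<cdot> f = f"
    and comp_assoc:
      "\<lbrakk>f \<in> hom X A B; g \<in> hom X B C; h \<in> hom X C D\<rbrakk> \<Longrightarrow> (h \<cdot> g) \<cdot> f = h \<cdot> (g \<cdot> f)"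

definition inverse_arrows :: "('o, 'm, 'x) category_scheme \<Rightarrow> 'm \<Rightarrow> 'm \<Rightarrow> bool" where
  "inverse_arrows X f g \<longleftrightarrow>
     f \<in> Arr X \<and> g \<in> hom X (Cod X f) (Dom X f) \<and>
     comp X g f = ident X (Dom X f) \<and> comp X f g = ident X (Cod X f)"

definition iso_arrow :: "('o, 'm, 'x) category_scheme \<Rightarrow> 'm \<Rightarrow> bool" where
  "iso_arrow X f \<longleftrightarrow> (\<exists>g. inverse_arrows X f g)"

definition inverse_arrow :: "('o, 'm, 'x) category_scheme \<Rightarrow> 'm \<Rightarrow> 'm" where
  "inverse_arrow X f = (THE g. inverse_arrows X f g)"

record ('o, 'm) biproduct_category = "('o, 'm) category" +
  zobj :: 'o  ("\<zero>\<index>")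
  biprod :: "'o \<Rightarrow> 'o \<Rightarrow> 'o"  (infixr "\<oplus>\<index>" 65)
  inj1 :: "'o \<Rightarrow> 'o \<Rightarrow> 'm"
  inj2 :: "'o \<Rightarrow> 'o \<Rightarrow> 'm"
  proj1 :: "'o \<Rightarrow> 'o \<Rightarrow> 'm"
  proj2 :: "'o \<Rightarrow> 'o \<Rightarrow> 'm"

definition zero_map :: "('o, 'm, 'x) biproduct_category_scheme \<Rightarrow> 'o \<Rightarrow> 'o \<Rightarrow> 'm" where
  "zero_map X A B =
     comp X (THE g. g \<in> hom X (zobj X) B) (THE f. f \<in> hom X A (zobj X))"

locale biproduct_category = category X
  for X :: "('o, 'm, 'x) biproduct_category_scheme" (structure) +
  assumes zobj_Obj: "\<zero> \<in> Obj X"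
    and zobj_terminal: "A \<in> Obj X \<Longrightarrow> \<exists>!f. f \<in> hom X A \<zero>"
    and zobj_initial: "A \<in> Obj X \<Longrightarrow> \<exists>!f. f \<in> hom X \<zero> A"
    and biprod_Obj: "\<lbrakk>A \<in> Obj X; B \<in> Obj X\<rbrakk> \<Longrightarrow> A \<oplus> B \<in> Obj X"
    and inj1_hom: "\<lbrakk>A \<in> Obj X; B \<in> Obj X\<rbrakk> \<Longrightarrow> inj1 X A B \<in> hom X A (A \<oplus> B)"
    and inj2_hom: "\<lbrakk>A \<in> Obj X; B \<in> Obj X\<rbrakk> \<Longrightarrow> inj2 X A B \<in> hom X B (A \<oplus> B)"
    and proj1_hom: "\<lbrakk>A \<in> Obj X; B \<in> Obj X\<rbrakk> \<Longrightarrow> proj1 X A B \<in> hom X (A \<oplus> B) A"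
    and proj2_hom: "\<lbrakk>A \<in> Obj X; B \<in> Obj X\<rbrakk> \<Longrightarrow> proj2 X A B \<in> hom X (A \<oplus> B) B"
    and product:
      "\<lbrakk>A \<in> Obj X; B \<in> Obj X; f \<in> hom X C A; g \<in> hom X C B\<rbrakk> \<Longrightarrow>
         \<exists>!h. h \<in> hom X C (A \<oplus> B) \<and> proj1 X A B \<cdot> h = f \<and> proj2 X A B \<cdot> h = g"
    and coproduct:
      "\<lbrakk>A \<in> Obj X; B \<in> Obj X; f \<in> hom X A C; g \<in> hom X B C\<rbrakk> \<Longrightarrow>
         \<exists>!h. h \<in> hom X (A \<oplus> B) C \<and> h \<cdot> inj1 X A B = f \<and> h \<cdot> inj2 X A B = g"
    and proj1_inj1: "\<lbrakk>A \<in> Obj X; B \<in> Obj X\<rbrakk> \<Longrightarrow> proj1 X A B \<cdot> inj1 X A B = ident X A"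
    and proj2_inj2: "\<lbrakk>A \<in> Obj X; B \<in> Obj X\<rbrakk> \<Longrightarrow> proj2 X A B \<cdot> inj2 X A B = ident X B"
    and proj2_inj1: "\<lbrakk>A \<in> Obj X; B \<in> Obj X\<rbrakk> \<Longrightarrow> proj2 X A B \<cdot> inj1 X A B = zero_map X A B"
    and proj1_inj2: "\<lbrakk>A \<in> Obj X; B \<in> Obj X\<rbrakk> \<Longrightarrow> proj1 X A B \<cdot> inj2 X A B = zero_map X B A"

definition pair :: "('o, 'm, 'x) biproduct_category_scheme \<Rightarrow> 'm \<Rightarrow> 'm \<Rightarrow> 'm" where
  "pair X f g =
     (THE h. h \<in> hom X (Dom X f) (biprod X (Cod X f) (Cod X g)) \<and>
        comp X (proj1 X (Cod X f) (Cod X g)) h = f \<and>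
        comp X (proj2 X (Cod X f) (Cod X g)) h = g)"

definition copair :: "('o, 'm, 'x) biproduct_category_scheme \<Rightarrow> 'm \<Rightarrow> 'm \<Rightarrow> 'm" where
  "copair X f g =
     (THE h. h \<in> hom X (biprod X (Dom X f) (Dom X g)) (Cod X f) \<and>
        comp X h (inj1 X (Dom X f) (Dom X g)) = f \<and>
        comp X h (inj2 X (Dom X f) (Dom X g)) = g)"

definition biprod_map :: "('o, 'm, 'x) biproduct_category_scheme \<Rightarrow> 'm \<Rightarrow> 'm \<Rightarrow> 'm" where
  "biprod_map X f g =
     pair X (comp X f (proj1 X (Dom X f) (Dom X g))) (comp X g (proj2 X (Dom X f) (Dom X g)))"

text \<open>
  The commutative monoid enrichment is not extra data: the sum of parallel maps
  \<open>f, g : A \<rightarrow> B\<close> is the composite of \<open>\<langle>f, g\<rangle> : A \<rightarrow> B \<oplus> B\<close> with the codiagonal \<open>[1, 1]\<close>.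
\<close>

definition map_add :: "('o, 'm, 'x) biproduct_category_scheme \<Rightarrow> 'm \<Rightarrow> 'm \<Rightarrow> 'm"
  (infixl "\<boxplus>\<index>" 65) where
  "f \<boxplus>\<^bsub>X\<^esub> g = comp X (copair X (ident X (Cod X f)) (ident X (Cod X f))) (pair X f g)"

definition has_negatives :: "('o, 'm, 'x) biproduct_category_scheme \<Rightarrow> bool" where
  "has_negatives X \<longleftrightarrow>
     (\<forall>A \<in> Obj X. \<forall>B \<in> Obj X. \<forall>f \<in> hom X A B. \<exists>g \<in> hom X A B. f \<boxplus>\<^bsub>X\<^esub> g = zero_map X A B)"

definition map_neg :: "('o, 'm, 'x) biproduct_category_scheme \<Rightarrow> 'm \<Rightarrow> 'm" where
  "map_neg X f =
     (THE g. g \<in> hom X (Dom X f) (Cod X f) \<and> f \<boxplus>\<^bsub>X\<^esub> g = zero_map X (Dom X f) (Cod X f))"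

definition map_diff :: "('o, 'm, 'x) biproduct_category_scheme \<Rightarrow> 'm \<Rightarrow> 'm \<Rightarrow> 'm"
  (infixl "\<boxminus>\<index>" 65) where
  "f \<boxminus>\<^bsub>X\<^esub> g = f \<boxplus>\<^bsub>X\<^esub> map_neg X g"

record ('o, 'm) monad =
  TObj :: "'o \<Rightarrow> 'o"
  TArr :: "'m \<Rightarrow> 'm"
  mu :: "'o \<Rightarrow> 'm"
  eta :: "'o \<Rightarrow> 'm"

locale monad = category X
  for X :: "('o, 'm, 'x) category_scheme" (structure) +
  fixes T :: "('o, 'm) monad"
  assumes TObj_Obj: "A \<in> Obj X \<Longrightarrow> TObj T A \<in> Obj X"
    and TArr_hom: "f \<in> hom X A B \<Longrightarrow> TArr T f \<in> hom X (TObj T A) (TObj T B)"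
    and TArr_ident: "A \<in> Obj X \<Longrightarrow> TArr T (ident X A) = ident X (TObj T A)"
    and TArr_comp:
      "\<lbrakk>f \<in> hom X A B; g \<in> hom X B C\<rbrakk> \<Longrightarrow> TArr T (g \<cdot> f) = TArr T g \<cdot> TArr T f"
    and mu_hom: "A \<in> Obj X \<Longrightarrow> mu T A \<in> hom X (TObj T (TObj T A)) (TObj T A)"
    and mu_natural: "f \<in> hom X A B \<Longrightarrow> mu T B \<cdot> TArr T (TArr T f) = TArr T f \<cdot> mu T A"
    and eta_hom: "A \<in> Obj X \<Longrightarrow> eta T A \<in> hom X A (TObj T A)"
    and eta_natural: "f \<in> hom X A B \<Longrightarrow> eta T B \<cdot> f = TArr T f \<cdot> eta T A"
    and mu_assoc: "A \<in> Obj X \<Longrightarrow> mu T A \<cdot> TArr T (mu T A) = mu T A \<cdot> mu T (TObj T A)"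
    and mu_eta: "A \<in> Obj X \<Longrightarrow> mu T A \<cdot> eta T (TObj T A) = ident X (TObj T A)"
    and mu_T_eta: "A \<in> Obj X \<Longrightarrow> mu T A \<cdot> TArr T (eta T A) = ident X (TObj T A)"

definition fusion ::
  "('o, 'm, 'x) biproduct_category_scheme \<Rightarrow> ('o, 'm) monad \<Rightarrow> 'o \<Rightarrow> 'o \<Rightarrow> 'm" where
  "fusion X T A B =
     comp X (inj1 X (TObj T A) (TObj T B)) (TArr T (proj1 X A (TObj T B)))
     \<boxplus>\<^bsub>X\<^esub> comp X (inj2 X (TObj T A) (TObj T B)) (comp X (mu T B) (TArr T (proj2 X A (TObj T B))))"

text \<open>
  The fusion operator is always natural in both arguments (for maps \<open>f \<oplus> T g\<close>), so it is a
  natural isomorphism exactly when all its components are isomorphisms.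
\<close>

locale hopf_monad = biproduct_category X + monad X T
  for X :: "('o, 'm, 'x) biproduct_category_scheme" (structure) and T :: "('o, 'm) monad" +
  assumes fusion_iso: "\<lbrakk>A \<in> Obj X; B \<in> Obj X\<rbrakk> \<Longrightarrow> iso_arrow X (fusion X T A B)"

text \<open>Only the values of \<open>k\<close> on objects matter.\<close>

locale fusion_invertor = biproduct_category X + monad X T
  for X :: "('o, 'm, 'x) biproduct_category_scheme" (structure) and T :: "('o, 'm) monad" +
  fixes k :: "'o \<Rightarrow> 'm"
  assumes invertor_hom:
      "A \<in> Obj X \<Longrightarrow> k A \<in> hom X (TObj T A) (TObj T (A \<oplus> TObj T \<zero>))"
    and invertor_natural:
      "f \<in> hom X A B \<Longrightarrow>
         TArr T (biprod_map X f (ident X (TObj T \<zero>))) \<cdot> k A = k B \<cdot> TArr T f"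
    and FI1: "A \<in> Obj X \<Longrightarrow> TArr T (proj1 X A (TObj T \<zero>)) \<cdot> k A = ident X (TObj T A)"
    and FI2:
      "A \<in> Obj X \<Longrightarrow>
         mu T \<zero> \<cdot> TArr T (proj2 X A (TObj T \<zero>)) \<cdot> k A = zero_map X (TObj T A) (TObj T \<zero>)"
    and FI3:
      "\<lbrakk>A \<in> Obj X; B \<in> Obj X\<rbrakk> \<Longrightarrow>
         (TArr T (biprod_map X (ident X A) (TArr T (zero_map X \<zero> B)))
            \<cdot> k A \<cdot> TArr T (proj1 X A (TObj T B)))
         \<boxplus> (TArr T (inj2 X A (TObj T B)) \<cdot> eta T (TObj T B)
            \<cdot> mu T B \<cdot> TArr T (proj2 X A (TObj T B)))
         = ident X (TObj T (A \<oplus> TObj T B))"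

end

theory Submission
  imports Defs
begin

text \<open>
  Both formulas come from one computation: the map \<open>g\<close> on the right of the second formula is a right
  inverse of the fusion operator \<open>h\<close>. Indeed \<open>h \<circ> T(\<iota>\<^sub>1) = \<iota>\<^sub>1 + \<iota>\<^sub>2 \<circ> T(0)\<close>, since
  \<open>\<mu> \<circ> T(0) = \<mu> \<circ> T(\<eta>) \<circ> T(0) = T(0)\<close>, and \<open>h \<circ> T(\<iota>\<^sub>2) \<circ> \<eta> = \<iota>\<^sub>2\<close> by naturality of \<open>\<eta>\<close>;
  the two terms with \<open>T(0)\<close> cancel. As \<open>h\<close> is invertible, \<open>g\<close> is its inverse, and [FI.3]
  for \<open>T(\<iota>\<^sub>1) - T(\<iota>\<^sub>2) \<circ> \<eta> \<circ> T(0)\<close> is the equation \<open>g \<circ> h = 1\<close>. Finally [FI.1] and [FI.2] say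
  that \<open>h\<close> composed with a fusion invertor is \<open>\<iota>\<^sub>1\<close>, which determines the invertor.
\<close>

section \<open>The enrichment of a category with finite biproducts\<close>

lemma hom_iff: "f \<in> hom X A B \<longleftrightarrow> f \<in> Arr X \<and> Dom X f = A \<and> Cod X f = B"
  by (auto simp: hom_def)

section \<open>Typing rules and inverses in a category\<close>

context category
begin

text \<open>Typing by \<open>hom\<close> is restated as equations for \<open>Dom\<close> and
  \<open>Cod\<close>, so that the simplifier can compute the type of any composite. This form of
  typing rule recurs throughout.\<close>

lemma ident_arr [simp]:
  assumes "A \<in> Obj X"
  shows "ident X A \<in> Arr X" "Dom X (ident X A) = A" "Cod X (ident X A) = A"
  using ident_hom[OF assms] by (auto simp: hom_iff)

lemma comp_arr [simp]:
  assumes "f \<in> Arr X" "g \<in> Arr X" "Cod X f = Dom X g"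
  shows "g \<cdot> f \<in> Arr X" "Dom X (g \<cdot> f) = Dom X f" "Cod X (g \<cdot> f) = Cod X g"
  using comp_hom[of f "Dom X f" "Cod X f" g "Cod X g"] assms by (auto simp: hom_iff)

lemma comp_ident_arr [simp]: "f \<in> Arr X \<Longrightarrow> A = Dom X f \<Longrightarrow> f \<cdot> ident X A = f"
  using comp_ident[of f "Dom X f" "Cod X f"] by (auto simp: hom_iff)

lemma ident_comp_arr [simp]: "f \<in> Arr X \<Longrightarrow> A = Cod X f \<Longrightarrow> ident X A \<cdot> f = f"
  using ident_comp[of f "Dom X f" "Cod X f"] by (auto simp: hom_iff)

lemma comp_assoc_arr [simp]:
  "f \<in> Arr X \<Longrightarrow> g \<in> Arr X \<Longrightarrow> h \<in> Arr X \<Longrightarrow> Cod X f = Dom X g \<Longrightarrow> Cod X g = Dom X h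
    \<Longrightarrow> (h \<cdot> g) \<cdot> f = h \<cdot> (g \<cdot> f)"
  using comp_assoc[of f "Dom X f" "Cod X f" g "Cod X g" h "Cod X h"] by (auto simp: hom_iff)

text \<open>If \<open>g'\<close> inverts \<open>f\<close>, then
  \<open>g' = g' \<cdot> f \<cdot> g = g\<close>. Hence only one composite of the fusion operator
  with its candidate inverse has to be computed.\<close>

lemma inverse_arrow_eq:
  assumes "iso_arrow X f" and g: "g \<in> hom X (Cod X f) (Dom X f)" and fg: "f \<cdot> g = ident X (Cod X f)"
  shows "inverse_arrow X f = g" and "g \<cdot> f = ident X (Dom X f)"
proof -
  have unique: "g' = g" if g': "inverse_arrows X f g'" for g'
  proof -
    have f: "f \<in> hom X (Dom X f) (Cod X f)" and g'_hom: "g' \<in> hom X (Cod X f) (Dom X f)"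
      using g' by (simp_all add: inverse_arrows_def hom_iff)
    show ?thesis
      using comp_assoc[OF g f g'_hom] comp_ident[OF g'_hom] ident_comp[OF g] g' fg
      by (simp add: inverse_arrows_def)
  qed
  obtain g' where "inverse_arrows X f g'"
    using assms(1) by (auto simp: iso_arrow_def)
  then have inv: "inverse_arrows X f g"
    using unique[of g'] by simp
  then show "inverse_arrow X f = g"
    unfolding inverse_arrow_def by (rule the_equality) (rule unique)
  show "g \<cdot> f = ident X (Dom X f)"
    using inv by (simp add: inverse_arrows_def)
qed

end

section \<open>Zero maps, pairings and copairings\<close>

context biproduct_category
begin

lemma Dom_Cod_Obj [simp]: "f \<in> Arr X \<Longrightarrow> Dom X f \<in> Obj X" "f \<in> Arr X \<Longrightarrow> Cod X f \<in> Obj X"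
  by (simp_all add: Dom_Obj Cod_Obj)

declare zobj_Obj [simp] biprod_Obj [simp]

lemma inj1_arr [simp]:
  assumes "A \<in> Obj X" "B \<in> Obj X"
  shows "inj1 X A B \<in> Arr X" "Dom X (inj1 X A B) = A" "Cod X (inj1 X A B) = A \<oplus> B"
  using inj1_hom[OF assms] by (auto simp: hom_iff)

lemma inj2_arr [simp]:
  assumes "A \<in> Obj X" "B \<in> Obj X"
  shows "inj2 X A B \<in> Arr X" "Dom X (inj2 X A B) = B" "Cod X (inj2 X A B) = A \<oplus> B"
  using inj2_hom[OF assms] by (auto simp: hom_iff)

lemma proj1_arr [simp]:
  assumes "A \<in> Obj X" "B \<in> Obj X"
  shows "proj1 X A B \<in> Arr X" "Dom X (proj1 X A B) = A \<oplus> B" "Cod X (proj1 X A B) = A"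
  using proj1_hom[OF assms] by (auto simp: hom_iff)

lemma proj2_arr [simp]:
  assumes "A \<in> Obj X" "B \<in> Obj X"
  shows "proj2 X A B \<in> Arr X" "Dom X (proj2 X A B) = A \<oplus> B" "Cod X (proj2 X A B) = B"
  using proj2_hom[OF assms] by (auto simp: hom_iff)

lemma zero_factor:
  assumes "A \<in> Obj X" "B \<in> Obj X"
  obtains t i where "t \<in> hom X A \<zero>" "i \<in> hom X \<zero> B" "zero_map X A B = i \<cdot> t"
proof
  show "(THE t. t \<in> hom X A \<zero>) \<in> hom X A \<zero>" "(THE i. i \<in> hom X \<zero> B) \<in> hom X \<zero> B"
    using theI'[OF zobj_terminal[OF assms(1)]] theI'[OF zobj_initial[OF assms(2)]] .
qed (simp add: zero_map_def)

text \<open>Maps into and out of \<open>\<zero>\<close> are unique, so the two descriptions in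
  \<open>zero_map\<close> may be replaced by arbitrary witnesses. Absorption of zero maps under
  composition follows.\<close>

lemma zero_mapI:
  assumes "t \<in> hom X A \<zero>" "i \<in> hom X \<zero> B"
  shows "i \<cdot> t = zero_map X A B"
proof -
  have "A \<in> Obj X" "B \<in> Obj X"
    using assms by (auto simp: hom_iff)
  then show ?thesis
    using assms the1_equality[OF zobj_terminal assms(1)] the1_equality[OF zobj_initial assms(2)]
    by (simp add: zero_map_def)
qed

lemma zero_map_arr [simp]:
  assumes "A \<in> Obj X" "B \<in> Obj X"
  shows "zero_map X A B \<in> Arr X" "Dom X (zero_map X A B) = A" "Cod X (zero_map X A B) = B"
  by (rule zero_factor[OF assms]; simp add: hom_iff)+

lemma zero_map_comp [simp]:
  assumes "f \<in> Arr X" "Cod X f = A" "B \<in> Obj X"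
  shows "zero_map X A B \<cdot> f = zero_map X (Dom X f) B"
proof -
  obtain t i where "t \<in> hom X A \<zero>" "i \<in> hom X \<zero> B" "zero_map X A B = i \<cdot> t"
    by (rule zero_factor[of A B]) (use assms in auto)
  then show ?thesis
    using zero_mapI[of "t \<cdot> f" "Dom X f" i B] assms by (auto simp: hom_iff)
qed

lemma comp_zero_map [simp]:
  assumes "f \<in> Arr X" "Dom X f = B" "A \<in> Obj X"
  shows "f \<cdot> zero_map X A B = zero_map X A (Cod X f)"
proof -
  obtain t i where "t \<in> hom X A \<zero>" "i \<in> hom X \<zero> B" "zero_map X A B = i \<cdot> t"
    by (rule zero_factor[of A B]) (use assms in auto)
  then show ?thesis
    using zero_mapI[of t A "f \<cdot> i" "Cod X f"] assms by (auto simp: hom_iff)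
qed

lemma proj_inj [simp]:
  assumes "A \<in> Obj X" "B \<in> Obj X"
  shows "proj1 X A B \<cdot> inj1 X A B = ident X A" "proj2 X A B \<cdot> inj2 X A B = ident X B"
    "proj2 X A B \<cdot> inj1 X A B = zero_map X A B" "proj1 X A B \<cdot> inj2 X A B = zero_map X B A"
  using assms by (simp_all add: proj1_inj1 proj2_inj2 proj2_inj1 proj1_inj2)

text \<open>Composites are normalised to the right, which hides the pattern of
  \<open>proj_inj\<close> as soon as a further factor stands behind it. These variants carry that
  factor; \<open>proj_pair_comp\<close> and \<open>copair_inj_comp\<close> do the same for their
  rules.\<close>

lemma proj_inj_comp [simp]:
  assumes "A \<in> Obj X" "B \<in> Obj X" "f \<in> Arr X"
  shows "Cod X f = A \<Longrightarrow> proj1 X A B \<cdot> inj1 X A B \<cdot> f = f"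
    "Cod X f = B \<Longrightarrow> proj2 X A B \<cdot> inj2 X A B \<cdot> f = f"
    "Cod X f = A \<Longrightarrow> proj2 X A B \<cdot> inj1 X A B \<cdot> f = zero_map X (Dom X f) B"
    "Cod X f = B \<Longrightarrow> proj1 X A B \<cdot> inj2 X A B \<cdot> f = zero_map X (Dom X f) A"
  using assms by (simp_all flip: comp_assoc_arr)

lemma biprod_ext:
  assumes "h \<in> hom X C (A \<oplus> B)" "h' \<in> hom X C (A \<oplus> B)" "A \<in> Obj X" "B \<in> Obj X"
    and "proj1 X A B \<cdot> h = proj1 X A B \<cdot> h'" "proj2 X A B \<cdot> h = proj2 X A B \<cdot> h'"
  shows "h = h'"
  using product[of A B "proj1 X A B \<cdot> h" C "proj2 X A B \<cdot> h"] assms by (auto simp: hom_iff)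

lemma biprod_coext:
  assumes "h \<in> hom X (A \<oplus> B) C" "h' \<in> hom X (A \<oplus> B) C" "A \<in> Obj X" "B \<in> Obj X"
    and "h \<cdot> inj1 X A B = h' \<cdot> inj1 X A B" "h \<cdot> inj2 X A B = h' \<cdot> inj2 X A B"
  shows "h = h'"
  using coproduct[of A B "h \<cdot> inj1 X A B" C "h \<cdot> inj2 X A B"] assms by (auto simp: hom_iff)

lemma pair_arr [simp]:
  assumes "f \<in> Arr X" "g \<in> Arr X" "Dom X f = Dom X g"
  shows "pair X f g \<in> Arr X" "Dom X (pair X f g) = Dom X g"
    "Cod X (pair X f g) = Cod X f \<oplus> Cod X g"
    and proj1_pair: "A = Cod X f \<Longrightarrow> B = Cod X g \<Longrightarrow> proj1 X A B \<cdot> pair X f g = f"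
    and proj2_pair: "A = Cod X f \<Longrightarrow> B = Cod X g \<Longrightarrow> proj2 X A B \<cdot> pair X f g = g"
  using theI'[OF product[of "Cod X f" "Cod X g" f "Dom X f" g]] assms
  by (auto simp: pair_def hom_iff)

lemma copair_arr [simp]:
  assumes "f \<in> Arr X" "g \<in> Arr X" "Cod X f = Cod X g"
  shows "copair X f g \<in> Arr X" "Dom X (copair X f g) = Dom X f \<oplus> Dom X g"
    "Cod X (copair X f g) = Cod X g"
    and copair_inj1: "A = Dom X f \<Longrightarrow> B = Dom X g \<Longrightarrow> copair X f g \<cdot> inj1 X A B = f"
    and copair_inj2: "A = Dom X f \<Longrightarrow> B = Dom X g \<Longrightarrow> copair X f g \<cdot> inj2 X A B = g"
  using theI'[OF coproduct[of "Dom X f" "Dom X g" f "Cod X f" g]] assms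
  by (auto simp: copair_def hom_iff)

lemma proj_pair_comp [simp]:
  assumes "f \<in> Arr X" "g \<in> Arr X" "Dom X f = Dom X g" "h \<in> Arr X" "Cod X h = Dom X g"
    "A = Cod X f" "B = Cod X g"
  shows "proj1 X A B \<cdot> pair X f g \<cdot> h = f \<cdot> h" "proj2 X A B \<cdot> pair X f g \<cdot> h = g \<cdot> h"
  using assms by (simp_all flip: comp_assoc_arr)

lemma pair_comp:
  assumes "f \<in> Arr X" "g \<in> Arr X" "Dom X f = Dom X g" "h \<in> Arr X" "Cod X h = Dom X g"
  shows "pair X f g \<cdot> h = pair X (f \<cdot> h) (g \<cdot> h)"
  by (rule biprod_ext[of _ "Dom X h" "Cod X f" "Cod X g"]) (use assms in \<open>simp_all add: hom_iff\<close>)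

lemma pair_zero:
  assumes "f \<in> Arr X" "A = Dom X f" "B \<in> Obj X"
  shows "pair X f (zero_map X A B) = inj1 X (Cod X f) B \<cdot> f"
    and "pair X (zero_map X A B) f = inj2 X B (Cod X f) \<cdot> f"
  by (rule biprod_ext[of _ "Dom X f" "Cod X f" B]; use assms in \<open>simp add: hom_iff\<close>)
     (rule biprod_ext[of _ "Dom X f" B "Cod X f"]; use assms in \<open>simp add: hom_iff\<close>)

lemma biprod_map_arr [simp]:
  assumes "f \<in> Arr X" "g \<in> Arr X"
  shows "biprod_map X f g \<in> Arr X" "Dom X (biprod_map X f g) = Dom X f \<oplus> Dom X g"
    "Cod X (biprod_map X f g) = Cod X f \<oplus> Cod X g"
  using assms by (simp_all add: biprod_map_def)

lemma biprod_map_inj: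
  assumes "f \<in> Arr X" "g \<in> Arr X" "A = Dom X f" "B = Dom X g"
  shows "biprod_map X f g \<cdot> inj1 X A B = inj1 X (Cod X f) (Cod X g) \<cdot> f"
    and "biprod_map X f g \<cdot> inj2 X A B = inj2 X (Cod X f) (Cod X g) \<cdot> g"
  using assms by (simp_all add: biprod_map_def pair_comp pair_zero)

lemma copair_inj_comp [simp]:
  assumes "f \<in> Arr X" "g \<in> Arr X" "Cod X f = Cod X g" "h \<in> Arr X" "A = Dom X f" "B = Dom X g"
  shows "Cod X h = A \<Longrightarrow> copair X f g \<cdot> inj1 X A B \<cdot> h = f \<cdot> h"
    "Cod X h = B \<Longrightarrow> copair X f g \<cdot> inj2 X A B \<cdot> h = g \<cdot> h"
  using assms by (simp_all flip: comp_assoc_arr)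

section \<open>Sums of parallel maps\<close>

lemma add_arr [simp]:
  assumes "f \<in> Arr X" "g \<in> Arr X" "Dom X f = Dom X g" "Cod X f = Cod X g"
  shows "f \<boxplus> g \<in> Arr X" "Dom X (f \<boxplus> g) = Dom X g" "Cod X (f \<boxplus> g) = Cod X g"
  using assms by (simp_all add: map_add_def)

lemma add_comp:
  assumes "f \<in> Arr X" "g \<in> Arr X" "Dom X f = Dom X g" "Cod X f = Cod X g"
    and "h \<in> Arr X" "Cod X h = Dom X g"
  shows "(f \<boxplus> g) \<cdot> h = f \<cdot> h \<boxplus> g \<cdot> h"
  using assms by (simp add: map_add_def pair_comp)

lemma add_zero [simp]:
  assumes "f \<in> Arr X" "A = Dom X f" "B = Cod X f"
  shows "f \<boxplus> zero_map X A B = f" and "zero_map X A B \<boxplus> f = f"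
  using assms by (simp_all add: map_add_def pair_zero)

lemma comp_add:
  assumes [simp]: "f \<in> Arr X" "g \<in> Arr X" "Dom X f = Dom X g" "Cod X f = Cod X g"
    and [simp]: "h \<in> Arr X" "Dom X h = Cod X g"
  shows "h \<cdot> (f \<boxplus> g) = h \<cdot> f \<boxplus> h \<cdot> g"
proof -
  define B where "B = Cod X g"
  define C where "C = Cod X h"
  \<comment> \<open>\<open>hh\<close> is \<open>h \<oplus> h\<close>, written as a pairing. Testing
    on both injections shows that the codiagonal is natural for it, which carries \<open>h\<close>
    past the codiagonal in \<open>map_add\<close>.\<close>
  define hh where "hh = pair X (h \<cdot> proj1 X B B) (h \<cdot> proj2 X B B)"
  have [simp]: "Cod X g = B" "Cod X h = C" "B \<in> Obj X" "C \<in> Obj X" "Dom X h = B" "Cod X f = B"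
    using Dom_Cod_Obj(2)[OF assms(2)] Dom_Cod_Obj(2)[OF assms(5)] by (simp_all add: B_def C_def)
  have "h \<cdot> copair X (ident X B) (ident X B) = copair X (ident X C) (ident X C) \<cdot> hh"
    by (rule biprod_coext[of _ B B C])
       (simp_all add: hom_iff hh_def pair_comp pair_zero)
  moreover have "hh \<cdot> pair X f g = pair X (h \<cdot> f) (h \<cdot> g)"
    by (simp add: hh_def pair_comp)
  ultimately show ?thesis
    unfolding map_add_def
    by (simp add: hh_def flip: comp_assoc_arr) (simp add: hh_def)
qed

lemma pair_add:
  assumes "a \<in> hom X A B" "b \<in> hom X A C" "c \<in> hom X A B" "d \<in> hom X A C"
  shows "pair X (a \<boxplus> c) (b \<boxplus> d) = pair X a b \<boxplus> pair X c d"
  by (rule biprod_ext[of _ A B C]) (use assms in \<open>auto simp: hom_iff comp_add\<close>)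

text \<open>The middle-four interchange holds because the codiagonal, like every map, preserves sums.\<close>

lemma add_interchange:
  assumes "a \<in> hom X A B" "b \<in> hom X A B" "c \<in> hom X A B" "d \<in> hom X A B"
  shows "(a \<boxplus> b) \<boxplus> (c \<boxplus> d) = (a \<boxplus> c) \<boxplus> (b \<boxplus> d)"
proof -
  have *: "f \<boxplus> g = copair X (ident X B) (ident X B) \<cdot> pair X f g"
    if "f \<in> hom X A B" "g \<in> hom X A B" for f g
    using that by (simp add: map_add_def hom_iff)
  have "(a \<boxplus> c) \<boxplus> (b \<boxplus> d) = copair X (ident X B) (ident X B) \<cdot> (pair X a b \<boxplus> pair X c d)"
    using assms by (subst *) (auto simp: hom_iff pair_add[of a A B b B c d])
  also have "\<dots> = (a \<boxplus> b) \<boxplus> (c \<boxplus> d)"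
    using assms by (subst comp_add) (auto simp: hom_iff *)
  finally show ?thesis by simp
qed

text \<open>Eckmann-Hilton: zero maps in the two outer slots turn the interchange law into
  commutativity.\<close>

lemma add_commute:
  assumes "a \<in> hom X A B" "b \<in> hom X A B"
  shows "a \<boxplus> b = b \<boxplus> a"
  using add_interchange[of "zero_map X A B" A B a b "zero_map X A B"] assms
  by (auto simp: hom_iff)

text \<open>Again the interchange law, now with a zero map in the third slot.\<close>

lemma add_assoc:
  assumes "a \<in> hom X A B" "b \<in> hom X A B" "c \<in> hom X A B"
  shows "(a \<boxplus> b) \<boxplus> c = a \<boxplus> (b \<boxplus> c)"
  using add_interchange[of a A B b "zero_map X A B" c] assms
  by (auto simp: hom_iff)

text \<open>Both sides have projections \<open>f\<close> and \<open>g\<close>. This turns the fusion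
  operator into a pairing and, for \<open>f\<close> and \<open>g\<close> the two projections,
  decomposes the identity of a biproduct.\<close>

lemma inj_add_inj:
  assumes "f \<in> Arr X" "g \<in> Arr X" "Dom X f = Dom X g"
  shows "inj1 X (Cod X f) (Cod X g) \<cdot> f \<boxplus> inj2 X (Cod X f) (Cod X g) \<cdot> g = pair X f g"
  by (rule biprod_ext[of _ "Dom X f" "Cod X f" "Cod X g"])
     (use assms in \<open>simp_all add: hom_iff comp_add\<close>)

end

section \<open>Negatives and differences\<close>

locale additive_category = biproduct_category +
  assumes negatives: "has_negatives X"
begin

lemma neg_unique:
  assumes "f \<in> hom X A B" "g \<in> hom X A B" "f \<boxplus> g = zero_map X A B"
    and "g' \<in> hom X A B" "f \<boxplus> g' = zero_map X A B"
  shows "g = g'"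
proof -
  have "g = g \<boxplus> (f \<boxplus> g')"
    using assms by (auto simp: hom_iff)
  also have "\<dots> = (f \<boxplus> g) \<boxplus> g'"
    unfolding add_assoc[OF assms(2,1,4), symmetric] add_commute[OF assms(1,2)] ..
  also have "\<dots> = g'"
    using assms by (auto simp: hom_iff)
  finally show ?thesis .
qed

lemma neg_eqI:
  assumes "f \<in> hom X A B" "g \<in> hom X A B" "f \<boxplus> g = zero_map X A B"
  shows "map_neg X f = g"
proof -
  have "Dom X f = A" "Cod X f = B"
    using assms(1) by (simp_all add: hom_iff)
  then show ?thesis
    unfolding map_neg_def by (simp, intro the_equality) (use assms neg_unique in blast)+
qed

lemma neg_arr [simp]:
  assumes "f \<in> Arr X"
  shows "map_neg X f \<in> Arr X" "Dom X (map_neg X f) = Dom X f" "Cod X (map_neg X f) = Cod X f"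
    and add_neg: "f \<boxplus> map_neg X f = zero_map X (Dom X f) (Cod X f)"
proof -
  have "f \<in> hom X (Dom X f) (Cod X f)"
    using assms by (simp add: hom_iff)
  moreover obtain g where "g \<in> hom X (Dom X f) (Cod X f)" "f \<boxplus> g = zero_map X (Dom X f) (Cod X f)"
    using negatives assms calculation unfolding has_negatives_def by (meson Dom_Cod_Obj)
  ultimately show "map_neg X f \<in> Arr X" "Dom X (map_neg X f) = Dom X f"
    "Cod X (map_neg X f) = Cod X f" "f \<boxplus> map_neg X f = zero_map X (Dom X f) (Cod X f)"
    using neg_eqI[of f "Dom X f" "Cod X f" g] by (simp_all add: hom_iff)
qed

text \<open>Composition preserves sums and zero maps, so \<open>h \<cdot> map_neg X f\<close> is an
  additive inverse of \<open>h \<cdot> f\<close>; negatives are unique.\<close>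

lemma comp_neg:
  assumes "f \<in> Arr X" "h \<in> Arr X" "Dom X h = Cod X f"
  shows "h \<cdot> map_neg X f = map_neg X (h \<cdot> f)"
  by (rule neg_eqI[symmetric, of _ "Dom X f" "Cod X h"])
     (use assms in \<open>simp_all add: hom_iff add_neg flip: comp_add\<close>)

lemma neg_comp:
  assumes "f \<in> Arr X" "h \<in> Arr X" "Cod X h = Dom X f"
  shows "map_neg X f \<cdot> h = map_neg X (f \<cdot> h)"
  by (rule neg_eqI[symmetric, of _ "Dom X h" "Cod X f"])
     (use assms in \<open>simp_all add: hom_iff add_neg flip: add_comp\<close>)

lemma diff_arr [simp]:
  assumes "f \<in> Arr X" "g \<in> Arr X" "Dom X f = Dom X g" "Cod X f = Cod X g"
  shows "f \<boxminus> g \<in> Arr X" "Dom X (f \<boxminus> g) = Dom X g" "Cod X (f \<boxminus> g) = Cod X g"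
  using assms by (simp_all add: map_diff_def)

lemma diff_comp:
  assumes "f \<in> Arr X" "g \<in> Arr X" "Dom X f = Dom X g" "Cod X f = Cod X g"
    and "h \<in> Arr X" "Cod X h = Dom X g"
  shows "(f \<boxminus> g) \<cdot> h = f \<cdot> h \<boxminus> g \<cdot> h"
  using assms by (simp add: map_diff_def add_comp neg_comp)

lemma comp_diff:
  assumes "f \<in> Arr X" "g \<in> Arr X" "Dom X f = Dom X g" "Cod X f = Cod X g"
    and "h \<in> Arr X" "Dom X h = Cod X g"
  shows "h \<cdot> (f \<boxminus> g) = h \<cdot> f \<boxminus> h \<cdot> g"
  using assms by (simp add: map_diff_def comp_add comp_neg)

lemma add_diff_cancel:
  assumes "f \<in> hom X A B" "g \<in> hom X A B"
  shows "f \<boxplus> g \<boxminus> g = f"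
  using assms add_assoc[of f A B g "map_neg X g"] by (auto simp: map_diff_def hom_iff add_neg)

end

section \<open>The fusion operator and its inverse\<close>

locale additive_hopf_monad = hopf_monad + additive_category
begin

section \<open>The monad laws as rewrite rules\<close>

declare TObj_Obj [simp] TArr_ident [simp]

lemma TArr_arr [simp]:
  assumes "f \<in> Arr X"
  shows "TArr T f \<in> Arr X" "Dom X (TArr T f) = TObj T (Dom X f)" "Cod X (TArr T f) = TObj T (Cod X f)"
  using TArr_hom[of f "Dom X f" "Cod X f"] assms by (auto simp: hom_iff)

lemma mu_arr [simp]:
  assumes "A \<in> Obj X"
  shows "mu T A \<in> Arr X" "Dom X (mu T A) = TObj T (TObj T A)" "Cod X (mu T A) = TObj T A"
  using mu_hom[OF assms] by (auto simp: hom_iff)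

lemma eta_arr [simp]:
  assumes "A \<in> Obj X"
  shows "eta T A \<in> Arr X" "Dom X (eta T A) = A" "Cod X (eta T A) = TObj T A"
  using eta_hom[OF assms] by (auto simp: hom_iff)

text \<open>Oriented so that images under the functor merge; the biproduct identities can then
  simplify inside \<open>TArr T\<close>.\<close>

lemma TArr_comp_arr [simp]:
  assumes "f \<in> Arr X" "g \<in> Arr X" "Cod X f = Dom X g"
  shows "TArr T g \<cdot> TArr T f = TArr T (g \<cdot> f)"
    and "h \<in> Arr X \<Longrightarrow> Cod X h = TObj T (Dom X f) \<Longrightarrow> TArr T g \<cdot> TArr T f \<cdot> h = TArr T (g \<cdot> f) \<cdot> h"
proof -
  show *: "TArr T g \<cdot> TArr T f = TArr T (g \<cdot> f)"
    using TArr_comp[of f "Dom X f" "Cod X f" g "Cod X g"] assms by (simp add: hom_iff)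
  show "TArr T g \<cdot> TArr T f \<cdot> h = TArr T (g \<cdot> f) \<cdot> h" if "h \<in> Arr X" "Cod X h = TObj T (Dom X f)"
    using that assms by (simp add: * flip: comp_assoc_arr)
qed

text \<open>As a rewrite rule, naturality of the unit moves \<open>eta\<close> outwards. It is
  switched off wherever \<open>TArr T (inj2 X A (TObj T B)) \<cdot> eta T (TObj T B)\<close> has to
  keep its shape.\<close>

lemma TArr_eta [simp]:
  assumes "f \<in> Arr X" "Dom X f = A"
  shows "TArr T f \<cdot> eta T A = eta T (Cod X f) \<cdot> f"
    and "h \<in> Arr X \<Longrightarrow> Cod X h = A \<Longrightarrow> TArr T f \<cdot> eta T A \<cdot> h = eta T (Cod X f) \<cdot> f \<cdot> h"
proof -
  show *: "TArr T f \<cdot> eta T A = eta T (Cod X f) \<cdot> f"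
    using eta_natural[of f A "Cod X f"] assms by (simp add: hom_iff)
  show "TArr T f \<cdot> eta T A \<cdot> h = eta T (Cod X f) \<cdot> f \<cdot> h" if "h \<in> Arr X" "Cod X h = A"
  proof -
    have "TArr T f \<cdot> eta T A \<cdot> h = (TArr T f \<cdot> eta T A) \<cdot> h"
      using that assms by (intro comp_assoc_arr[symmetric]) auto
    then show ?thesis
      using that assms unfolding * by simp
  qed
qed

lemma mu_eta_arr [simp]:
  assumes "A \<in> Obj X"
  shows "mu T A \<cdot> eta T (TObj T A) = ident X (TObj T A)"
    and "h \<in> Arr X \<Longrightarrow> Cod X h = TObj T A \<Longrightarrow> mu T A \<cdot> eta T (TObj T A) \<cdot> h = h"
  using mu_eta assms by (simp_all flip: comp_assoc_arr)

text \<open>The functor need not preserve zero maps, so no side can be assumed to vanish. Instead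
  the zero map into \<open>TObj T B\<close> factors through \<open>eta T B\<close>, and the unit law
  \<open>mu_T_eta\<close> removes the multiplication.\<close>

lemma mu_TArr_zero [simp]:
  assumes "A \<in> Obj X" "B \<in> Obj X"
  shows "mu T B \<cdot> TArr T (zero_map X A (TObj T B)) = TArr T (zero_map X A B)"
proof -
  have "TArr T (zero_map X A (TObj T B)) = TArr T (eta T B) \<cdot> TArr T (zero_map X A B)"
    using assms by simp
  then have "mu T B \<cdot> TArr T (zero_map X A (TObj T B)) = (mu T B \<cdot> TArr T (eta T B)) \<cdot> TArr T (zero_map X A B)"
    using assms by (simp del: TArr_comp_arr)
  then show ?thesis
    using assms by (simp add: mu_T_eta)
qed

section \<open>The fusion operator as a pairing, and a right inverse of it\<close>

lemma fusion_eq_pair: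
  assumes "A \<in> Obj X" "B \<in> Obj X"
  shows "fusion X T A B = pair X (TArr T (proj1 X A (TObj T B))) (mu T B \<cdot> TArr T (proj2 X A (TObj T B)))"
  unfolding fusion_def
  using assms inj_add_inj[of "TArr T (proj1 X A (TObj T B))" "mu T B \<cdot> TArr T (proj2 X A (TObj T B))"]
  by simp

lemma fusion_arr [simp]:
  assumes "A \<in> Obj X" "B \<in> Obj X"
  shows "fusion X T A B \<in> Arr X" "Dom X (fusion X T A B) = TObj T (A \<oplus> TObj T B)"
    "Cod X (fusion X T A B) = TObj T A \<oplus> TObj T B"
  using assms by (simp_all add: fusion_eq_pair)

text \<open>The formula claimed for the invertor, with a general \<open>B\<close> in place of
  \<open>\<zero>\<close>. For every \<open>B\<close> it is also the leg of the inverse fusion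
  operator on the first summand.\<close>

definition fusion_section :: "'a \<Rightarrow> 'a \<Rightarrow> 'b" where
  "fusion_section A B = TArr T (inj1 X A (TObj T B))
     \<boxminus> TArr T (inj2 X A (TObj T B)) \<cdot> eta T (TObj T B) \<cdot> TArr T (zero_map X A B)"

lemma fusion_section_arr [simp]:
  assumes "A \<in> Obj X" "B \<in> Obj X"
  shows "fusion_section A B \<in> Arr X" "Dom X (fusion_section A B) = TObj T A"
    "Cod X (fusion_section A B) = TObj T (A \<oplus> TObj T B)"
  using assms by (simp_all add: fusion_section_def del: TArr_eta)

text \<open>The first component is \<open>TArr T\<close> of a zero map after \<open>eta\<close>,
  which is zero by naturality of the unit; the second is \<open>mu\<close> after \<open>eta\<close>,
  an identity.\<close>

lemma fusion_comp_inj2: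
  assumes "A \<in> Obj X" "B \<in> Obj X"
  shows "fusion X T A B \<cdot> TArr T (inj2 X A (TObj T B)) \<cdot> eta T (TObj T B)
    = inj2 X (TObj T A) (TObj T B)"
  using assms pair_zero(2)[of "ident X (TObj T B)" "TObj T B" "TObj T A"]
  by (simp add: fusion_eq_pair pair_comp)

lemma fusion_comp_section:
  assumes [simp]: "A \<in> Obj X" "B \<in> Obj X"
  shows "fusion X T A B \<cdot> fusion_section A B = inj1 X (TObj T A) (TObj T B)"
proof -
  let ?h = "fusion X T A B" and ?z = "TArr T (zero_map X A B)"
    and ?i = "TArr T (inj2 X A (TObj T B)) \<cdot> eta T (TObj T B)"
  have "?h \<cdot> TArr T (inj1 X A (TObj T B)) = pair X (ident X (TObj T A)) ?z"
    by (simp add: fusion_eq_pair pair_comp)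
  also have "\<dots> = inj1 X (TObj T A) (TObj T B) \<boxplus> inj2 X (TObj T A) (TObj T B) \<cdot> ?z"
    using inj_add_inj[of "ident X (TObj T A)" ?z] by simp
  finally have 1: "?h \<cdot> TArr T (inj1 X A (TObj T B))
    = inj1 X (TObj T A) (TObj T B) \<boxplus> inj2 X (TObj T A) (TObj T B) \<cdot> ?z" .
  \<comment> \<open>Bracketing \<open>?h\<close> with \<open>?i\<close> exposes the pattern of
    \<open>fusion_comp_inj2\<close>, so the subtracted term is sent to exactly the surplus summand
    in \<open>1\<close>.\<close>
  have "?h \<cdot> ?i \<cdot> ?z = (?h \<cdot> ?i) \<cdot> ?z"
    by (simp del: TArr_eta)
  then have 2: "?h \<cdot> TArr T (inj2 X A (TObj T B)) \<cdot> eta T (TObj T B) \<cdot> ?z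
    = inj2 X (TObj T A) (TObj T B) \<cdot> ?z"
    unfolding fusion_comp_inj2[OF assms] by (simp del: TArr_eta)
  show ?thesis
    unfolding fusion_section_def
    by (subst comp_diff)
       (simp_all add: 1 2 hom_iff add_diff_cancel[of _ "TObj T A" "TObj T A \<oplus> TObj T B"] del: TArr_eta)
qed

text \<open>The map out of the biproduct whose legs are \<open>fusion_section A B\<close> and
  \<open>TArr T (inj2 X A (TObj T B)) \<cdot> eta T (TObj T B)\<close>. The fusion operator sends
  these legs to the two injections.\<close>

definition fusion_inverse :: "'a \<Rightarrow> 'a \<Rightarrow> 'b" where
  "fusion_inverse A B = fusion_section A B \<cdot> proj1 X (TObj T A) (TObj T B)
     \<boxplus> TArr T (inj2 X A (TObj T B)) \<cdot> eta T (TObj T B) \<cdot> proj2 X (TObj T A) (TObj T B)"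

lemma fusion_inverse_hom:
  "A \<in> Obj X \<Longrightarrow> B \<in> Obj X \<Longrightarrow>
    fusion_inverse A B \<in> hom X (TObj T A \<oplus> TObj T B) (TObj T (A \<oplus> TObj T B))"
  by (simp add: fusion_inverse_def hom_iff del: TArr_eta)

lemma fusion_comp_inverse:
  assumes [simp]: "A \<in> Obj X" "B \<in> Obj X"
  shows "fusion X T A B \<cdot> fusion_inverse A B = ident X (TObj T A \<oplus> TObj T B)"
proof -
  let ?h = "fusion X T A B" and ?p = "proj1 X (TObj T A) (TObj T B)"
    and ?q = "proj2 X (TObj T A) (TObj T B)"
    and ?i = "TArr T (inj2 X A (TObj T B)) \<cdot> eta T (TObj T B)"
  have "?h \<cdot> fusion_inverse A B = (?h \<cdot> fusion_section A B) \<cdot> ?p \<boxplus> (?h \<cdot> ?i) \<cdot> ?q"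
    unfolding fusion_inverse_def by (subst comp_add) (simp_all del: TArr_eta)
  also have "\<dots> = pair X ?p ?q"
    unfolding fusion_comp_inj2[OF assms] fusion_comp_section[OF assms]
    using inj_add_inj[of ?p ?q] by simp
  also have "\<dots> = ident X (TObj T A \<oplus> TObj T B)"
    by (rule biprod_ext[of _ "TObj T A \<oplus> TObj T B" "TObj T A" "TObj T B"]) (simp_all add: hom_iff)
  finally show ?thesis .
qed

text \<open>The Hopf condition enters here and makes the right inverse two-sided; the second
  equation is the source of [FI.3].\<close>

lemma inverse_fusion:
  assumes "A \<in> Obj X" "B \<in> Obj X"
  shows "inverse_arrow X (fusion X T A B) = fusion_inverse A B"
    and "fusion_inverse A B \<cdot> fusion X T A B = ident X (TObj T (A \<oplus> TObj T B))"
  using inverse_arrow_eq[OF fusion_iso[OF assms], of "fusion_inverse A B"]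
    fusion_inverse_hom[OF assms] fusion_comp_inverse[OF assms] assms
  by simp_all

lemma fusion_monic:
  assumes [simp]: "A \<in> Obj X" "B \<in> Obj X"
    and [simp]: "f \<in> Arr X" "g \<in> Arr X" "Cod X f = TObj T (A \<oplus> TObj T B)"
      "Cod X g = TObj T (A \<oplus> TObj T B)"
    and eq: "fusion X T A B \<cdot> f = fusion X T A B \<cdot> g"
  shows "f = g"
proof -
  have *: "e = fusion_inverse A B \<cdot> fusion X T A B \<cdot> e"
    if "e \<in> Arr X" "Cod X e = TObj T (A \<oplus> TObj T B)" for e
    using that inverse_fusion(2)[OF assms(1,2)] fusion_inverse_hom[OF assms(1,2)]
    by (simp add: hom_iff flip: comp_assoc_arr)
  have "f = fusion_inverse A B \<cdot> fusion X T A B \<cdot> f" by (rule *) simp_all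
  also have "\<dots> = g" unfolding eq by (rule *[symmetric]) simp_all
  finally show ?thesis .
qed

section \<open>The fusion invertor\<close>

text \<open>One computation for two uses: \<open>b\<close> an identity on \<open>\<zero>\<close>
  gives naturality of the invertor, and \<open>f\<close> an identity with \<open>b\<close> the zero
  map out of \<open>\<zero>\<close> gives the first summand of [FI.3].\<close>

lemma TArr_biprod_map_comp_section:
  assumes [simp]: "f \<in> Arr X" "b \<in> Arr X" "Dom X b = B" "Cod X b = B'" and "A = Dom X f"
  shows "TArr T (biprod_map X f (TArr T b)) \<cdot> fusion_section A B
    = TArr T (inj1 X (Cod X f) (TObj T B') \<cdot> f)
      \<boxminus> TArr T (inj2 X (Cod X f) (TObj T B')) \<cdot> eta T (TObj T B') \<cdot> TArr T (zero_map X A B')"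
proof -
  have [simp]: "A \<in> Obj X" "B \<in> Obj X" "B' \<in> Obj X" "Dom X f = A"
    using assms Dom_Cod_Obj by blast+
  let ?m = "biprod_map X f (TArr T b)"
  \<comment> \<open>The map \<open>?m\<close> slides past \<open>inj2\<close> and leaves
    \<open>TArr T (TArr T b)\<close>; naturality of \<open>eta\<close> turns this into
    \<open>TArr T b\<close>, which the zero map then absorbs under the functor.\<close>
  have "TArr T ?m \<cdot> TArr T (inj2 X A (TObj T B)) \<cdot> eta T (TObj T B) \<cdot> TArr T (zero_map X A B)
    = TArr T (inj2 X (Cod X f) (TObj T B')) \<cdot> (TArr T (TArr T b) \<cdot> eta T (TObj T B)) \<cdot> TArr T (zero_map X A B)"
    by (simp add: biprod_map_inj del: TArr_eta)
  also have "\<dots> = TArr T (inj2 X (Cod X f) (TObj T B')) \<cdot> eta T (TObj T B') \<cdot> TArr T (zero_map X A B')"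
    by simp
  finally show ?thesis
    unfolding fusion_section_def by (subst comp_diff) (simp_all add: biprod_map_inj del: TArr_eta)
qed

lemma section_fusion_invertor: "fusion_invertor X T (\<lambda>A. fusion_section A \<zero>)"
proof unfold_locales
  fix A assume [simp]: "A \<in> Obj X"
  let ?p = "TArr T (proj1 X A (TObj T \<zero>))" and ?q = "mu T \<zero> \<cdot> TArr T (proj2 X A (TObj T \<zero>))"
  show "fusion_section A \<zero> \<in> hom X (TObj T A) (TObj T (A \<oplus> TObj T \<zero>))"
    by (simp add: hom_iff)
  \<comment> \<open>The two projections of this equation are [FI.1] and [FI.2].\<close>
  have *: "pair X ?p ?q \<cdot> fusion_section A \<zero> = inj1 X (TObj T A) (TObj T \<zero>)"
    using fusion_comp_section[of A \<zero>] by (simp add: fusion_eq_pair)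
  show "?p \<cdot> fusion_section A \<zero> = ident X (TObj T A)"
    using arg_cong[OF *, of "\<lambda>h. proj1 X (TObj T A) (TObj T \<zero>) \<cdot> h"] by simp
  show "mu T \<zero> \<cdot> TArr T (proj2 X A (TObj T \<zero>)) \<cdot> fusion_section A \<zero> = zero_map X (TObj T A) (TObj T \<zero>)"
    using arg_cong[OF *, of "\<lambda>h. proj2 X (TObj T A) (TObj T \<zero>) \<cdot> h"] by simp
next
  fix f A B assume "f \<in> hom X A B"
  then have f [simp]: "f \<in> Arr X" "Dom X f = A" "Cod X f = B" and [simp]: "A \<in> Obj X" "B \<in> Obj X"
    by (auto simp: hom_iff)
  have "fusion_section B \<zero> \<cdot> TArr T f = TArr T (inj1 X B (TObj T \<zero>) \<cdot> f)
      \<boxminus> TArr T (inj2 X B (TObj T \<zero>)) \<cdot> eta T (TObj T \<zero>) \<cdot> TArr T (zero_map X A \<zero>)"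
    unfolding fusion_section_def by (subst diff_comp) (simp_all del: TArr_eta)
  then show "TArr T (biprod_map X f (ident X (TObj T \<zero>))) \<cdot> fusion_section A \<zero>
      = fusion_section B \<zero> \<cdot> TArr T f"
    using TArr_biprod_map_comp_section[of f "ident X \<zero>" \<zero> \<zero> A] by (simp del: TArr_eta)
next
  fix A B assume [simp]: "A \<in> Obj X" "B \<in> Obj X"
  let ?m = "TArr T (biprod_map X (ident X A) (TArr T (zero_map X \<zero> B)))"
    and ?p = "TArr T (proj1 X A (TObj T B))"
    and ?q = "mu T B \<cdot> TArr T (proj2 X A (TObj T B))"
    and ?i = "TArr T (inj2 X A (TObj T B)) \<cdot> eta T (TObj T B)"
  \<comment> \<open>The zero map from \<open>A\<close> to \<open>B\<close> factors through
    \<open>\<zero>\<close>, so \<open>?m\<close> changes the parameter of the section from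
    \<open>\<zero>\<close> to \<open>B\<close>.\<close>
  have "?m \<cdot> fusion_section A \<zero> = fusion_section A B"
    using TArr_biprod_map_comp_section[of "ident X A" "zero_map X \<zero> B" \<zero> B A]
    by (simp add: fusion_section_def del: TArr_eta)
  then have m: "?m \<cdot> fusion_section A \<zero> \<cdot> ?p = fusion_section A B \<cdot> ?p"
    by (simp del: TArr_comp_arr flip: comp_assoc_arr)
  \<comment> \<open>With the fusion operator in pairing form, its projections are \<open>?p\<close>
    and \<open>?q\<close>, so the left inverse law becomes [FI.3].\<close>
  have "fusion_inverse A B \<cdot> fusion X T A B = fusion_section A B \<cdot> ?p \<boxplus> ?i \<cdot> ?q"
    unfolding fusion_inverse_def fusion_eq_pair[OF \<open>A \<in> Obj X\<close> \<open>B \<in> Obj X\<close>]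
    by (subst add_comp) (simp_all del: TArr_eta)
  then have "fusion_section A B \<cdot> ?p \<boxplus> ?i \<cdot> ?q = ident X (TObj T (A \<oplus> TObj T B))"
    by (simp add: inverse_fusion)
  then show "(?m \<cdot> fusion_section A \<zero> \<cdot> ?p)
      \<boxplus> (TArr T (inj2 X A (TObj T B)) \<cdot> eta T (TObj T B) \<cdot> mu T B \<cdot> TArr T (proj2 X A (TObj T B)))
      = ident X (TObj T (A \<oplus> TObj T B))"
    unfolding m by (simp del: TArr_eta)
qed

lemma fusion_invertor_unique:
  assumes "fusion_invertor X T k" and [simp]: "A \<in> Obj X"
  shows "k A = fusion_section A \<zero>"
proof (rule fusion_monic[of A \<zero>])
  interpret k: fusion_invertor X T k by fact
  show [simp]: "k A \<in> Arr X" "Cod X (k A) = TObj T (A \<oplus> TObj T \<zero>)"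
    using k.invertor_hom[of A] by (auto simp: hom_iff)
  have [simp]: "Dom X (k A) = TObj T A"
    using k.invertor_hom[of A] by (auto simp: hom_iff)
  \<comment> \<open>[FI.1] and [FI.2] give the two components of this composite.\<close>
  have "fusion X T A \<zero> \<cdot> k A = pair X (ident X (TObj T A)) (zero_map X (TObj T A) (TObj T \<zero>))"
    using k.FI1[of A] k.FI2[of A] by (simp add: fusion_eq_pair pair_comp)
  also have "\<dots> = inj1 X (TObj T A) (TObj T \<zero>)"
    by (simp add: pair_zero)
  finally show "fusion X T A \<zero> \<cdot> k A = fusion X T A \<zero> \<cdot> fusion_section A \<zero>"
    by (simp add: fusion_comp_section)
qed simp_all

lemma fusion_inverse_expand:
  assumes "A \<in> Obj X" "B \<in> Obj X"
  shows "fusion_inverse A B = (TArr T (inj1 X A (TObj T B)) \<cdot> proj1 X (TObj T A) (TObj T B))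
        \<boxminus> (TArr T (inj2 X A (TObj T B)) \<cdot> eta T (TObj T B) \<cdot> TArr T (zero_map X A B)
            \<cdot> proj1 X (TObj T A) (TObj T B))
        \<boxplus> (TArr T (inj2 X A (TObj T B)) \<cdot> eta T (TObj T B) \<cdot> proj2 X (TObj T A) (TObj T B))"
  unfolding fusion_inverse_def fusion_section_def
  using assms by (subst diff_comp) (simp_all del: TArr_eta)

end

theorem lemma6p2:
  fixes X :: "('o, 'm, 'x) biproduct_category_scheme" (structure)
    and T :: "('o, 'm) monad"
  assumes "hopf_monad X T"
    and "has_negatives X"
  shows "(\<exists>k. fusion_invertor X T k) \<and>
    (\<forall>k. fusion_invertor X T k \<longrightarrow>
      (\<forall>A \<in> Obj X.
        k A = TArr T (inj1 X A (TObj T \<zero>))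
          \<boxminus> (TArr T (inj2 X A (TObj T \<zero>)) \<cdot> eta T (TObj T \<zero>) \<cdot> TArr T (zero_map X A \<zero>)))) \<and>
    (\<forall>A \<in> Obj X. \<forall>B \<in> Obj X.
      inverse_arrow X (fusion X T A B) =
        (TArr T (inj1 X A (TObj T B)) \<cdot> proj1 X (TObj T A) (TObj T B))
        \<boxminus> (TArr T (inj2 X A (TObj T B)) \<cdot> eta T (TObj T B) \<cdot> TArr T (zero_map X A B)
            \<cdot> proj1 X (TObj T A) (TObj T B))
        \<boxplus> (TArr T (inj2 X A (TObj T B)) \<cdot> eta T (TObj T B) \<cdot> proj2 X (TObj T A) (TObj T B)))"
proof -
  interpret hopf_monad X T by fact
  interpret additive_hopf_monad X T by unfold_locales fact
  show ?thesis
  proof (intro conjI allI ballI impI)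
    \<comment> \<open>Existence ensures that the formula for every invertor is not vacuous.\<close>
    show "\<exists>k. fusion_invertor X T k"
      by (intro exI) (rule section_fusion_invertor)
  next
    fix k A assume "fusion_invertor X T k" "A \<in> Obj X"
    then show "k A = TArr T (inj1 X A (TObj T \<zero>))
        \<boxminus> (TArr T (inj2 X A (TObj T \<zero>)) \<cdot> eta T (TObj T \<zero>) \<cdot> TArr T (zero_map X A \<zero>))"
      unfolding fusion_section_def[symmetric] by (rule fusion_invertor_unique)
  qed (simp only: inverse_fusion(1) fusion_inverse_expand)
qed

end
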